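(* For every $m\in\mathcal M_n$, let $\widehat s_m=\widehat s_m(X_{1,n})$ be the projection estimator $\widehat s_m=\sum_{\lambda\in\Lambda(m)}\big(\frac1n\sum_{i=1}^n\varphi_\lambda(X_i)\big)\varphi_\lambda$. Then for every $p\in\{1,\ldots,n-1\}$, the leave-$p$-out risk estimator of $\widehat s_m$ satisfies $$\widehat R_p(m)=\frac{1}{n(n-p)}\sum_{\lambda\in\Lambda(m)}\Big[\sum_{j=1}^n\varphi_\lambda^2(X_j)-\frac{n-p+1}{n-1}\sum_{j\ne k}\varphi_\lambda(X_j)\varphi_\lambda(X_k)\Big],$$ where the last sum is over ordered pairs $(j,k)\in\{1,\ldots,n\}^2$ with $j\neq k$.
   Context: $X_{1,n}=(X_1,\ldots,X_n)$ are i.i.d. random variables in $[0,1]$ with density $s\in L^2([0,1])$; $\|\cdot\|$ is the norm of $L^2([0,1])$. For $m\in\mathcal M_n$ ($\mathcal M_n$ countable), $\{\varphi_\lambda\}_{\lambda\in\Lambda(m)}$ is a finite orthonormal family of real-valued measurable functions in $L^2([0,1])$. For $e\subset\{1,\ldots,n\}$ with $\mathrm{Card}(e)=p$, $\widehat s_m(X^{(e)})=\sum_{\lambda\in\Lambda(m)}\big(\frac1{n-p}\sum_{i\notin e}\varphi_\lambda(X_i)\big)\varphi_\lambda$ is the same estimator computed from the $n-p$ observations with index not in $e$. With $\gamma(u;x)=\|u\|^2-2u(x)$ and $\mathcal E_p=\{e\subset\{1,\ldots,n\}:\mathrm{Card}(e)=p\}$, the leave-$p$-out risk estimator is $$\widehat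 R_p(m)=\widehat R_p(\widehat s_m)=\binom np^{-1}\sum_{e\in\mathcal E_p}\frac1p\sum_{i\in e}\gamma\big(\widehat s_m(X^{(e)});X_i\big).$$ *)

theory Defs
  imports "HOL-Probability.Probability"
begin

text \<open>Lebesgue measure on the Borel sets of the unit interval; its space is \<open>{0..1}\<close>, so functions
  on the unit interval are total functions on the reals whose values outside are irrelevant.\<close>

definition unit_lborel :: "real measure" where
  "unit_lborel = restrict_space lborel {0..1}"

definition L2_unit :: "(real \<Rightarrow> real) set" where
  "L2_unit = {u. u \<in> borel_measurable unit_lborel \<and> integrable unit_lborel (\<lambda>t. (u t)\<^sup>2)}"

definition L2_inner :: "(real \<Rightarrow> real) \<Rightarrow> (real \<Rightarrow> real) \<Rightarrow> real" where
  "L2_inner u v = (\<integral>t. u t * v t \<partial>unit_lborel)"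

definition L2_norm :: "(real \<Rightarrow> real) \<Rightarrow> real" where
  "L2_norm u = sqrt (L2_inner u u)"

definition finite_orthonormal_family :: "('l \<Rightarrow> real \<Rightarrow> real) \<Rightarrow> 'l set \<Rightarrow> bool" where
  "finite_orthonormal_family \<phi> L \<longleftrightarrow>
     finite L \<and> (\<forall>l\<in>L. \<phi> l \<in> L2_unit) \<and>
     (\<forall>l\<in>L. \<forall>l'\<in>L. L2_inner (\<phi> l) (\<phi> l') = (if l = l' then 1 else 0))"

text \<open>An estimator maps a finite set \<open>I\<close> of indices and a sequence \<open>x\<close> of observations to a function
  on the unit interval, using only the observations \<open>x i\<close> with \<open>i \<in> I\<close>.  Thus \<open>{1..n}\<close> gives the
  estimator from the full sample, and \<open>{1..n} - e\<close> the one from the sample with \<open>e\<close> left out.\<close>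

type_synonym estimator = "nat set \<Rightarrow> (nat \<Rightarrow> real) \<Rightarrow> real \<Rightarrow> real"

definition projection_estimator :: "('l \<Rightarrow> real \<Rightarrow> real) \<Rightarrow> 'l set \<Rightarrow> estimator" where
  "projection_estimator \<phi> L I x =
     (\<lambda>t. \<Sum>l\<in>L. (1 / real (card I) * (\<Sum>i\<in>I. \<phi> l (x i))) * \<phi> l t)"

definition contrast :: "(real \<Rightarrow> real) \<Rightarrow> real \<Rightarrow> real" where
  "contrast u y = (L2_norm u)\<^sup>2 - 2 * u y"

definition lpo_risk :: "nat \<Rightarrow> nat \<Rightarrow> estimator \<Rightarrow> (nat \<Rightarrow> real) \<Rightarrow> real" where
  "lpo_risk n p est x =
     1 / real (n choose p) *
     (\<Sum>e\<in>{e. e \<subseteq> {1..n} \<and> card e = p}.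
        1 / real p * (\<Sum>i\<in>e. contrast (est ({1..n} - e) x) (x i)))"

end

theory Submission
  imports Defs
begin

text \<open>The identity is deterministic, one sample point at a time, and its analytic input is the
  Pythagorean identity for an orthonormal family.  That identity turns the contrast of a
  projection estimator into a sum over \<open>\<lambda>\<close> of expressions in the numbers
  \<open>a i = \<phi>\<^sub>\<lambda> (X\<^sub>i)\<close> alone, so the claim separates over \<open>\<lambda>\<close>.

  For one \<open>\<lambda>\<close>, the summand of a left-out set \<open>e\<close> is a quadratic form in \<open>a\<close>: a multiple of the
  square of the sum of \<open>a\<close> off \<open>e\<close>, minus a multiple of the product of the sums on and off \<open>e\<close>.  Summing over all
  \<open>e\<close> with \<open>p\<close> elements and exchanging the order of summation, each \<open>a j * a k\<close> is weighted with
  the number of sets \<open>e\<close> that contain neither, or the first but not the second, of \<open>j\<close> and \<open>k\<close>.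
  By symmetry these numbers depend only on whether \<open>j = k\<close>; they are binomial coefficients
  (\<open>card_subsets_containing_avoiding\<close>), and dividing by \<open>n choose p\<close> leaves the probabilities
  \<open>(n - p) / n\<close>, \<open>(n - p) (n - p - 1) / (n (n - 1))\<close> and \<open>p (n - p) / (n (n - 1))\<close> for a uniformly
  random \<open>e\<close>.  The coefficient of the off-diagonal products is then
  \<open>1 / (n (n - 1)) * ((n - p - 1) / (n - p) - 2) = - (n - p + 1) / (n (n - p) (n - 1))\<close>.\<close>

section \<open>Orthonormal sums\<close>

lemma integrable_mult_L2_unit:
  assumes "u \<in> L2_unit" and "v \<in> L2_unit"
  shows "integrable unit_lborel (\<lambda>t. u t * v t)"
proof (rule Bochner_Integration.integrable_bound)
  show "integrable unit_lborel (\<lambda>t. (u t)\<^sup>2 + (v t)\<^sup>2)"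
    using assms by (auto simp: L2_unit_def)
  show "(\<lambda>t. u t * v t) \<in> borel_measurable unit_lborel"
    using assms by (auto simp: L2_unit_def)
  have "\<bar>x * y\<bar> \<le> x\<^sup>2 + y\<^sup>2" for x y :: real
  proof -
    have "2 * (\<bar>x\<bar> * \<bar>y\<bar>) \<le> x\<^sup>2 + y\<^sup>2"
      using sum_squares_bound[of "\<bar>x\<bar>" "\<bar>y\<bar>"] by (simp add: mult.assoc)
    moreover have "0 \<le> \<bar>x\<bar> * \<bar>y\<bar>" by simp
    ultimately show ?thesis unfolding abs_mult by linarith
  qed
  then show "AE t in unit_lborel. norm (u t * v t) \<le> norm ((u t)\<^sup>2 + (v t)\<^sup>2)"
    by simp
qed

lemma L2_norm_orthonormal_sum:
  assumes "finite_orthonormal_family \<phi> L"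
  shows "(L2_norm (\<lambda>t. \<Sum>l\<in>L. c l * \<phi> l t))\<^sup>2 = (\<Sum>l\<in>L. (c l)\<^sup>2)"
proof -
  have fin: "finite L" and L2: "\<And>l. l \<in> L \<Longrightarrow> \<phi> l \<in> L2_unit"
    and orth: "\<And>l l'. l \<in> L \<Longrightarrow> l' \<in> L \<Longrightarrow>
      (\<integral>t. \<phi> l t * \<phi> l' t \<partial>unit_lborel) = (if l = l' then 1 else 0)"
    using assms by (auto simp: finite_orthonormal_family_def L2_inner_def)
  have int: "integrable unit_lborel (\<lambda>t. c l * c l' * (\<phi> l t * \<phi> l' t))"
    if "l \<in> L" "l' \<in> L" for l l'
    using integrable_mult_L2_unit[OF L2 L2, OF that] by simp
  have "L2_inner (\<lambda>t. \<Sum>l\<in>L. c l * \<phi> l t) (\<lambda>t. \<Sum>l\<in>L. c l * \<phi> l t)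
      = (\<integral>t. (\<Sum>l\<in>L. \<Sum>l'\<in>L. c l * c l' * (\<phi> l t * \<phi> l' t)) \<partial>unit_lborel)"
    by (simp add: L2_inner_def sum_product mult_ac)
  also have "\<dots> = (\<Sum>l\<in>L. \<Sum>l'\<in>L. \<integral>t. c l * c l' * (\<phi> l t * \<phi> l' t) \<partial>unit_lborel)"
    using int by (simp add: Bochner_Integration.integral_sum Bochner_Integration.integrable_sum)
  also have "\<dots> = (\<Sum>l\<in>L. \<Sum>l'\<in>L. if l = l' then c l * c l' else 0)"
    by (intro sum.cong refl) (simp add: orth)
  also have "\<dots> = (\<Sum>l\<in>L. (c l)\<^sup>2)"
    using fin by (simp add: power2_eq_square)
  finally show ?thesis
    by (simp add: L2_norm_def sum_nonneg)
qed

section \<open>Counting left-out sets\<close>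

text \<open>Removing \<open>B\<close> from such a set \<open>e\<close> leaves an arbitrary subset of \<open>A - B - C\<close> with
  \<open>p - card B\<close> elements.\<close>

lemma card_subsets_containing_avoiding:
  assumes "finite A" "B \<subseteq> A" "C \<subseteq> A" "B \<inter> C = {}" "card B \<le> p"
  shows "card {e. e \<subseteq> A \<and> card e = p \<and> B \<subseteq> e \<and> e \<inter> C = {}}
    = (card A - card B - card C) choose (p - card B)"
proof -
  have fin: "finite B" "finite C"
    using assms by (auto intro: finite_subset)
  have "bij_betw (\<lambda>e. e - B) {e. e \<subseteq> A \<and> card e = p \<and> B \<subseteq> e \<and> e \<inter> C = {}}
    {d. d \<subseteq> A - B - C \<and> card d = p - card B}"
  proof (rule bij_betw_byWitness[where f' = "\<lambda>d. d \<union> B"])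
    show "(\<lambda>d. d \<union> B) ` {d. d \<subseteq> A - B - C \<and> card d = p - card B}
      \<subseteq> {e. e \<subseteq> A \<and> card e = p \<and> B \<subseteq> e \<and> e \<inter> C = {}}"
    proof clarify
      fix d assume d: "d \<subseteq> A - B - C" "card d = p - card B"
      have "card (d \<union> B) = card d + card B"
        using d(1) assms(1) fin by (intro card_Un_disjoint) (auto intro: finite_subset)
      then show "d \<union> B \<subseteq> A \<and> card (d \<union> B) = p \<and> B \<subseteq> d \<union> B \<and> (d \<union> B) \<inter> C = {}"
        using d assms by auto
    qed
  qed (use fin in \<open>auto simp: card_Diff_subset\<close>)
  then have "card {e. e \<subseteq> A \<and> card e = p \<and> B \<subseteq> e \<and> e \<inter> C = {}}
    = card {d. d \<subseteq> A - B - C \<and> card d = p - card B}"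
    by (rule bij_betw_same_card)
  also have "\<dots> = card (A - B - C) choose (p - card B)"
    using assms(1) by (intro n_subsets) auto
  also have "card (A - B - C) = card A - card B - card C"
  proof -
    have "C \<subseteq> A - B"
      using assms by auto
    then show ?thesis
      using assms fin by (simp add: card_Diff_subset)
  qed
  finally show ?thesis .
qed

section \<open>Sums over left-out sets\<close>

abbreviation (input) offdiag :: "'i set \<Rightarrow> ('i \<times> 'i) set" where
  "offdiag A \<equiv> {(j, k). j \<in> A \<and> k \<in> A \<and> j \<noteq> k}"

lemma finite_offdiag: "finite A \<Longrightarrow> finite (offdiag A)"
  by (rule finite_subset[of _ "A \<times> A"]) auto

lemma square_sum_eq_diag_offdiag:
  fixes a :: "'i \<Rightarrow> real"
  assumes "finite A"
  shows "(\<Sum>i\<in>A. a i)\<^sup>2 = (\<Sum>j\<in>A. (a j)\<^sup>2) + (\<Sum>(j, k)\<in>offdiag A. a j * a k)"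
proof -
  have split: "A \<times> A = (\<lambda>j. (j, j)) ` A \<union> offdiag A"
    by auto
  have "(\<Sum>i\<in>A. a i)\<^sup>2 = (\<Sum>(j, k)\<in>A \<times> A. a j * a k)"
    by (simp add: power2_eq_square sum_product sum.cartesian_product)
  also have "\<dots> = (\<Sum>(j, k)\<in>(\<lambda>j. (j, j)) ` A. a j * a k) + (\<Sum>(j, k)\<in>offdiag A. a j * a k)"
    unfolding split using assms finite_offdiag[OF assms] by (intro sum.union_disjoint) auto
  also have "(\<Sum>(j, k)\<in>(\<lambda>j. (j, j)) ` A. a j * a k) = (\<Sum>j\<in>A. (a j)\<^sup>2)"
    by (simp add: sum.reindex inj_on_def power2_eq_square)
  finally show ?thesis .
qed

text \<open>The exchange of summation: the weight of \<open>f z\<close> is the number of sets in \<open>E\<close> that see \<open>z\<close>.\<close>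

lemma sum_filtered_swap_const:
  fixes f :: "'z \<Rightarrow> real"
  assumes "finite E" "finite Z" "\<And>z. z \<in> Z \<Longrightarrow> card {e \<in> E. P e z} = N"
  shows "(\<Sum>e\<in>E. \<Sum>z\<in>{z \<in> Z. P e z}. f z) = real N * (\<Sum>z\<in>Z. f z)"
  using assms by (simp add: sum.swap_restrict sum_distrib_left)

lemma sum_subsets_square_complement:
  fixes a :: "'i \<Rightarrow> real"
  assumes "finite A"
  shows "(\<Sum>e | e \<subseteq> A \<and> card e = p. (\<Sum>i\<in>A - e. a i)\<^sup>2)
    = real ((card A - 1) choose p) * (\<Sum>j\<in>A. (a j)\<^sup>2)
      + real ((card A - 2) choose p) * (\<Sum>(j, k)\<in>offdiag A. a j * a k)"
proof -
  let ?E = "{e. e \<subseteq> A \<and> card e = p}"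
  have finE: "finite ?E"
    using assms by simp
  have diag: "card {e \<in> ?E. j \<notin> e} = (card A - 1) choose p" if "j \<in> A" for j
  proof -
    have "{e \<in> ?E. j \<notin> e} = {e. e \<subseteq> A \<and> card e = p \<and> {} \<subseteq> e \<and> e \<inter> {j} = {}}"
      by auto
    then show ?thesis
      using card_subsets_containing_avoiding[of A "{}" "{j}" p] assms that by simp
  qed
  have off: "card {e \<in> ?E. fst z \<notin> e \<and> snd z \<notin> e} = (card A - 2) choose p" if "z \<in> offdiag A" for z
  proof -
    have "{e \<in> ?E. fst z \<notin> e \<and> snd z \<notin> e}
      = {e. e \<subseteq> A \<and> card e = p \<and> {} \<subseteq> e \<and> e \<inter> {fst z, snd z} = {}}"
      by auto
    then show ?thesis
      using card_subsets_containing_avoiding[of A "{}" "{fst z, snd z}" p] assms that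
      by (auto simp: numeral_2_eq_2)
  qed
  have "(\<Sum>e\<in>?E. (\<Sum>i\<in>A - e. a i)\<^sup>2)
    = (\<Sum>e\<in>?E. \<Sum>j\<in>{j \<in> A. j \<notin> e}. (a j)\<^sup>2)
      + (\<Sum>e\<in>?E. \<Sum>z\<in>{z \<in> offdiag A. fst z \<notin> e \<and> snd z \<notin> e}. a (fst z) * a (snd z))"
    unfolding sum.distrib[symmetric]
  proof (intro sum.cong refl)
    fix e
    have "A - e = {j \<in> A. j \<notin> e}"
      and "offdiag (A - e) = {z \<in> offdiag A. fst z \<notin> e \<and> snd z \<notin> e}"
      by auto
    then show "(\<Sum>i\<in>A - e. a i)\<^sup>2 = (\<Sum>j\<in>{j \<in> A. j \<notin> e}. (a j)\<^sup>2)
      + (\<Sum>z\<in>{z \<in> offdiag A. fst z \<notin> e \<and> snd z \<notin> e}. a (fst z) * a (snd z))"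
      using square_sum_eq_diag_offdiag[of "A - e" a] assms by (simp add: case_prod_beta)
  qed
  also have "\<dots> = real ((card A - 1) choose p) * (\<Sum>j\<in>A. (a j)\<^sup>2)
      + real ((card A - 2) choose p) * (\<Sum>z\<in>offdiag A. a (fst z) * a (snd z))"
    using sum_filtered_swap_const[OF finE assms diag, where f = "\<lambda>j. (a j)\<^sup>2"]
      sum_filtered_swap_const[OF finE finite_offdiag[OF assms] off, where f = "\<lambda>z. a (fst z) * a (snd z)"]
    by simp
  finally show ?thesis
    by (simp add: case_prod_beta)
qed

lemma sum_subsets_product_complement:
  fixes a :: "'i \<Rightarrow> real"
  assumes "finite A" "1 \<le> p"
  shows "(\<Sum>e | e \<subseteq> A \<and> card e = p. (\<Sum>i\<in>e. a i) * (\<Sum>i\<in>A - e. a i))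
    = real ((card A - 2) choose (p - 1)) * (\<Sum>(j, k)\<in>offdiag A. a j * a k)"
proof -
  let ?E = "{e. e \<subseteq> A \<and> card e = p}"
  have finE: "finite ?E"
    using assms by simp
  have off: "card {e \<in> ?E. fst z \<in> e \<and> snd z \<notin> e} = (card A - 2) choose (p - 1)"
    if "z \<in> offdiag A" for z
  proof -
    have "{e \<in> ?E. fst z \<in> e \<and> snd z \<notin> e}
      = {e. e \<subseteq> A \<and> card e = p \<and> {fst z} \<subseteq> e \<and> e \<inter> {snd z} = {}}"
      by auto
    then show ?thesis
      using card_subsets_containing_avoiding[of A "{fst z}" "{snd z}" p] assms that
      by (auto simp: numeral_2_eq_2)
  qed
  have "(\<Sum>e\<in>?E. (\<Sum>i\<in>e. a i) * (\<Sum>i\<in>A - e. a i))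
    = (\<Sum>e\<in>?E. \<Sum>z\<in>{z \<in> offdiag A. fst z \<in> e \<and> snd z \<notin> e}. a (fst z) * a (snd z))"
  proof (intro sum.cong refl)
    fix e assume "e \<in> ?E"
    then have "e \<times> (A - e) = {z \<in> offdiag A. fst z \<in> e \<and> snd z \<notin> e}"
      by auto
    then show "(\<Sum>i\<in>e. a i) * (\<Sum>i\<in>A - e. a i)
      = (\<Sum>z\<in>{z \<in> offdiag A. fst z \<in> e \<and> snd z \<notin> e}. a (fst z) * a (snd z))"
      by (simp add: sum_product sum.cartesian_product case_prod_beta)
  qed
  also have "\<dots> = real ((card A - 2) choose (p - 1)) * (\<Sum>z\<in>offdiag A. a (fst z) * a (snd z))"
    by (rule sum_filtered_swap_const[OF finE finite_offdiag[OF assms(1)] off])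
  finally show ?thesis
    by (simp add: case_prod_beta)
qed

text \<open>The probabilities that a uniformly random \<open>p\<close>-subset of \<open>n\<close> points misses one given point,
  misses two given points, and contains the first but misses the second of two given points.\<close>

lemma binomial_ratios:
  fixes n p :: nat
  assumes "1 \<le> p" "p < n"
  shows "real ((n - 1) choose p) / real (n choose p) = (real n - real p) / real n"
    and "real ((n - 2) choose p) / real (n choose p)
      = (real n - real p) * (real n - real p - 1) / (real n * (real n - 1))"
    and "real ((n - 2) choose (p - 1)) / real (n choose p)
      = real p * (real n - real p) / (real n * (real n - 1))"
proof -
  have pos: "real (n choose p) > 0" "real n > 0" "real n - 1 > 0"
    using assms by auto
  have pred: "n - 1 - 1 = n - 2" "n - 1 - (p - 1) = n - p"
    using assms by auto
  have one: "(real n - real p) * real (n choose p) = real n * real ((n - 1) choose p)"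
    using arg_cong[OF binomial_absorb_comp[of n p], of real] assms by (simp add: of_nat_diff)
  have "real (n - 1 - p) = real n - real p - 1" "real (n - 1) = real n - 1"
    using assms by auto
  then have two: "(real n - real p - 1) * real ((n - 1) choose p) = (real n - 1) * real ((n - 2) choose p)"
    using arg_cong[OF binomial_absorb_comp[of "n - 1" p], of real]
    by (simp only: of_nat_mult pred)
  have "real p * real (n choose p) = real n * real ((n - 1) choose (p - 1))"
    using arg_cong[OF binomial_absorption[of "p - 1" n], of real] assms
    by (simp del: binomial_Suc_Suc)
  moreover have "(real n - real p) * real ((n - 1) choose (p - 1))
      = (real n - 1) * real ((n - 2) choose (p - 1))"
    using arg_cong[OF binomial_absorb_comp[of "n - 1" "p - 1"], of real]
      \<open>real (n - 1) = real n - 1\<close> assms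
    by (simp only: of_nat_mult pred of_nat_diff less_imp_le)
  ultimately have three: "real p * (real n - real p) * real (n choose p)
      = real n * (real n - 1) * real ((n - 2) choose (p - 1))"
    by algebra
  have two': "(real n - real p) * (real n - real p - 1) * real (n choose p)
      = real n * (real n - 1) * real ((n - 2) choose p)"
    using one two by algebra
  show "real ((n - 1) choose p) / real (n choose p) = (real n - real p) / real n"
    using pos one by (simp add: frac_eq_eq mult_ac)
  show "real ((n - 2) choose p) / real (n choose p)
      = (real n - real p) * (real n - real p - 1) / (real n * (real n - 1))"
    using pos two' by (simp add: frac_eq_eq mult_ac)
  show "real ((n - 2) choose (p - 1)) / real (n choose p)
      = real p * (real n - real p) / (real n * (real n - 1))"
    using pos three by (simp add: frac_eq_eq mult_ac)
qed

text \<open>The contribution of a single \<open>\<lambda>\<close> to the risk estimator, with \<open>a i = \<phi>\<^sub>\<lambda> (X\<^sub>i)\<close>.\<close>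

lemma average_leave_out_quadratic:
  fixes a :: "'i \<Rightarrow> real"
  assumes "finite A" and n: "card A = n" and p: "1 \<le> p" "p < n"
  shows "1 / real (n choose p) * (\<Sum>e | e \<subseteq> A \<and> card e = p.
      (1 / (real n - real p) * (\<Sum>i\<in>A - e. a i))\<^sup>2
      - 2 / (real p * (real n - real p)) * ((\<Sum>i\<in>e. a i) * (\<Sum>i\<in>A - e. a i)))
    = 1 / (real n * (real n - real p)) *
      ((\<Sum>j\<in>A. (a j)\<^sup>2)
       - (real n - real p + 1) / (real n - 1) * (\<Sum>(j, k)\<in>offdiag A. a j * a k))"
    (is "?lhs = ?rhs")
proof -
  define q where "q = real n - real p"
  define C where "C = real (n choose p)"
  define D where "D = (\<Sum>j\<in>A. (a j)\<^sup>2)"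
  define F where "F = (\<Sum>(j, k)\<in>offdiag A. a j * a k)"
  have pos: "q > 0" "real p > 0" "real n > 0" "real n - 1 > 0"
    using p by (auto simp: q_def)
  have "?lhs = 1 / C * (1 / q\<^sup>2 * (\<Sum>e | e \<subseteq> A \<and> card e = p. (\<Sum>i\<in>A - e. a i)\<^sup>2)
      - 2 / (real p * q) * (\<Sum>e | e \<subseteq> A \<and> card e = p. (\<Sum>i\<in>e. a i) * (\<Sum>i\<in>A - e. a i)))"
    unfolding C_def q_def
    by (simp only: sum_subtractf sum_distrib_left[symmetric] power_mult_distrib power_one_over)
  also have "\<dots> = 1 / q\<^sup>2 * (real ((n - 1) choose p) / C * D + real ((n - 2) choose p) / C * F)
      - 2 / (real p * q) * (real ((n - 2) choose (p - 1)) / C * F)"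
    unfolding sum_subsets_square_complement[OF assms(1)]
      sum_subsets_product_complement[OF assms(1) p(1)] n D_def F_def
    by (simp add: algebra_simps add_divide_distrib)
  also have "\<dots> = 1 / q\<^sup>2 * (q / real n * D + q * (q - 1) / (real n * (real n - 1)) * F)
      - 2 / (real p * q) * (real p * q / (real n * (real n - 1)) * F)"
    unfolding C_def binomial_ratios[OF p] q_def ..
  also have "\<dots> = 1 / (real n * q) * (D - (q + 1) / (real n - 1) * F)"
  proof -
    \<comment> \<open>The divisor \<open>real n - 1\<close> is made atomic, so that its nonvanishing is visible when clearing
      denominators.\<close>
    define r where "r = real n - 1"
    have "q \<noteq> 0" "real p \<noteq> 0" "real n \<noteq> 0" "r \<noteq> 0"
      using pos by (auto simp: r_def)
    then show ?thesis
      unfolding r_def[symmetric] by (simp add: divide_simps power2_eq_square) algebra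
  qed
  also have "\<dots> = ?rhs"
    by (simp add: q_def D_def F_def)
  finally show ?thesis .
qed

section \<open>The risk of a projection estimator\<close>

text \<open>By orthonormality \<open>\<parallel>u\<parallel>\<^sup>2\<close> has no cross terms between different \<open>\<lambda>\<close>, and the point
  evaluation in the contrast is linear in \<open>u\<close>; hence the mean contrast separates over \<open>\<lambda>\<close>.
  Here \<open>I\<close> indexes the training sample and \<open>e\<close> the test sample.\<close>

lemma mean_contrast_projection_estimator:
  assumes "finite_orthonormal_family \<phi> L" and e: "finite e" "e \<noteq> {}"
  shows "1 / real (card e) * (\<Sum>i\<in>e. contrast (projection_estimator \<phi> L I x) (x i))
    = (\<Sum>l\<in>L. (1 / real (card I) * (\<Sum>i\<in>I. \<phi> l (x i)))\<^sup>2
        - 2 / (real (card e) * real (card I)) * ((\<Sum>i\<in>e. \<phi> l (x i)) * (\<Sum>i\<in>I. \<phi> l (x i))))"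
proof -
  define c where "c l = 1 / real (card I) * (\<Sum>i\<in>I. \<phi> l (x i))" for l
  have est: "projection_estimator \<phi> L I x = (\<lambda>t. \<Sum>l\<in>L. c l * \<phi> l t)"
    by (simp add: projection_estimator_def c_def)
  have card: "real (card e) \<noteq> 0"
    using e by simp
  have "(\<Sum>i\<in>e. contrast (projection_estimator \<phi> L I x) (x i))
    = real (card e) * (\<Sum>l\<in>L. (c l)\<^sup>2) - 2 * (\<Sum>i\<in>e. \<Sum>l\<in>L. c l * \<phi> l (x i))"
    by (simp add: est contrast_def L2_norm_orthonormal_sum[OF assms(1)] sum_subtractf
        sum_distrib_left)
  also have "(\<Sum>i\<in>e. \<Sum>l\<in>L. c l * \<phi> l (x i)) = (\<Sum>l\<in>L. c l * (\<Sum>i\<in>e. \<phi> l (x i)))"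
    by (subst sum.swap) (simp add: sum_distrib_left)
  finally have "1 / real (card e) * (\<Sum>i\<in>e. contrast (projection_estimator \<phi> L I x) (x i))
    = (\<Sum>l\<in>L. (c l)\<^sup>2) - 2 / real (card e) * (\<Sum>l\<in>L. c l * (\<Sum>i\<in>e. \<phi> l (x i)))"
    using card by (simp add: right_diff_distrib)
  also have "\<dots> = (\<Sum>l\<in>L. (c l)\<^sup>2 - 2 / real (card e) * (c l * (\<Sum>i\<in>e. \<phi> l (x i))))"
    by (simp only: sum_subtractf sum_distrib_left)
  also have "\<dots> = (\<Sum>l\<in>L. (c l)\<^sup>2
      - 2 / (real (card e) * real (card I)) * ((\<Sum>i\<in>e. \<phi> l (x i)) * (\<Sum>i\<in>I. \<phi> l (x i))))"
    by (intro sum.cong refl) (simp add: c_def mult_ac)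
  finally show ?thesis
    by (simp add: c_def)
qed

lemma lpo_risk_projection_estimator:
  assumes orth: "finite_orthonormal_family \<phi> L" and p: "1 \<le> p" "p < n"
  shows "lpo_risk n p (projection_estimator \<phi> L) x =
    1 / (real n * (real n - real p)) *
    (\<Sum>l\<in>L. (\<Sum>j=1..n. (\<phi> l (x j))\<^sup>2)
       - (real n - real p + 1) / (real n - 1) *
         (\<Sum>(j, k)\<in>offdiag {1..n}. \<phi> l (x j) * \<phi> l (x k)))"
proof -
  let ?E = "{e. e \<subseteq> {1..n} \<and> card e = p}"
  let ?Q = "\<lambda>l e. (1 / (real n - real p) * (\<Sum>i\<in>{1..n} - e. \<phi> l (x i)))\<^sup>2
    - 2 / (real p * (real n - real p)) * ((\<Sum>i\<in>e. \<phi> l (x i)) * (\<Sum>i\<in>{1..n} - e. \<phi> l (x i)))"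
  have summand: "1 / real p * (\<Sum>i\<in>e. contrast (projection_estimator \<phi> L ({1..n} - e) x) (x i))
    = (\<Sum>l\<in>L. ?Q l e)" if "e \<in> ?E" for e
  proof -
    have e: "e \<subseteq> {1..n}" "card e = p" "finite e" "e \<noteq> {}"
      using that p by (auto intro: finite_subset)
    have "real (card ({1..n} - e)) = real n - real p"
      using e p by (simp add: card_Diff_subset of_nat_diff)
    then show ?thesis
      using mean_contrast_projection_estimator[OF orth e(3,4), of "{1..n} - e" x] e(2) by simp
  qed
  have "lpo_risk n p (projection_estimator \<phi> L) x
    = 1 / real (n choose p) * (\<Sum>e\<in>?E. \<Sum>l\<in>L. ?Q l e)"
    unfolding lpo_risk_def
    by (rule arg_cong[where f = "\<lambda>v. 1 / real (n choose p) * v"], rule sum.cong[OF refl summand])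
  also have "\<dots> = (\<Sum>l\<in>L. 1 / real (n choose p) * (\<Sum>e\<in>?E. ?Q l e))"
    by (subst sum.swap) (simp only: sum_distrib_left)
  also have "\<dots> = (\<Sum>l\<in>L. 1 / (real n * (real n - real p)) *
      ((\<Sum>j=1..n. (\<phi> l (x j))\<^sup>2)
       - (real n - real p + 1) / (real n - 1) *
         (\<Sum>(j, k)\<in>offdiag {1..n}. \<phi> l (x j) * \<phi> l (x k))))"
    using average_leave_out_quadratic[of "{1..n}" n p] p by (intro sum.cong refl) simp
  finally show ?thesis
    by (simp only: sum_distrib_left)
qed

theorem proposition2p1:
  fixes M :: "'a measure"
    and n :: nat
    and X :: "nat \<Rightarrow> 'a \<Rightarrow> real"
    and s :: "real \<Rightarrow> real"
    and Ms :: "'m set"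
    and \<Lambda> :: "'m \<Rightarrow> 'l set"
    and \<phi> :: "'l \<Rightarrow> real \<Rightarrow> real"
  assumes "prob_space M"
    and "s \<in> L2_unit" and "\<forall>t\<in>{0..1}. 0 \<le> s t"
    and "prob_space.indep_vars M (\<lambda>_. unit_lborel) X {1..n}"
    and "\<forall>i\<in>{1..n}. distributed M unit_lborel (X i) (\<lambda>t. ennreal (s t))"
    and "countable Ms"
    and "\<forall>m\<in>Ms. finite_orthonormal_family \<phi> (\<Lambda> m)"
  shows "\<forall>m\<in>Ms. \<forall>p\<in>{1..n - 1}. \<forall>\<omega>\<in>space M.
    lpo_risk n p (projection_estimator \<phi> (\<Lambda> m)) (\<lambda>i. X i \<omega>) =
      1 / (real n * (real n - real p)) *
      (\<Sum>l\<in>\<Lambda> m.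
         (\<Sum>j=1..n. (\<phi> l (X j \<omega>))\<^sup>2)
         - (real n - real p + 1) / (real n - 1) *
           (\<Sum>(j, k)\<in>{(j, k). j \<in> {1..n} \<and> k \<in> {1..n} \<and> j \<noteq> k}. \<phi> l (X j \<omega>) * \<phi> l (X k \<omega>)))"
proof (intro ballI)
  fix m p \<omega>
  assume m: "m \<in> Ms" and p: "p \<in> {1..n - 1}"
  then have "finite_orthonormal_family \<phi> (\<Lambda> m)" "1 \<le> p" "p < n"
    using assms by auto
  then show "lpo_risk n p (projection_estimator \<phi> (\<Lambda> m)) (\<lambda>i. X i \<omega>) =
      1 / (real n * (real n - real p)) *
      (\<Sum>l\<in>\<Lambda> m.
         (\<Sum>j=1..n. (\<phi> l (X j \<omega>))\<^sup>2)
         - (real n - real p + 1) / (real n - 1) *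
           (\<Sum>(j, k)\<in>{(j, k). j \<in> {1..n} \<and> k \<in> {1..n} \<and> j \<noteq> k}. \<phi> l (X j \<omega>) * \<phi> l (X k \<omega>)))"
    by (rule lpo_risk_projection_estimator)
qed

end
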